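(* Let $A\in\mathbb{R}^{2\times 2}$, let $\zeta\in\mathbb{R}^2$ be nonzero, let $\Omega=[u^-,u^+]$ with $u^-<u^+$, and consider the linear control system $\Sigma_{\mathbb{R}^2}$: $\dot v(t)=Av(t)+u(t)\zeta$, $u(t)\in\Omega$. Assume that $\Sigma_{\mathbb{R}^2}$ satisfies the LARC and that $\det A=\operatorname{tr}A=0$. Then: (a) if $0\in\operatorname{int}\Omega$, then $\Sigma_{\mathbb{R}^2}$ is controllable; (b) if $0\in\partial\Omega$, then $\mathbb{R}\cdot A\zeta$ is a continuum of one-point control sets, i.e. for every $\alpha\in\mathbb{R}$ the singleton $\{\alpha A\zeta\}$ is a control set of $\Sigma_{\mathbb{R}^2}$; (c) if $0\notin\Omega$, then $\Sigma_{\mathbb{R}^2}$ does not admit any control set.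
   Context: The set $\mathcal{U}$ of control functions consists of all piecewise constant functions $\mathbf{u}:\mathbb{R}\to\mathbb{R}$ with image in $\Omega$. For $v\in\mathbb{R}^2$ and $\mathbf{u}\in\mathcal{U}$, $s\mapsto\varphi(s,v,\mathbf{u})$, $s\in\mathbb{R}$, is the unique continuous, piecewise differentiable solution of $\frac{d}{ds}\varphi(s,v,\mathbf{u})=A\varphi(s,v,\mathbf{u})+\mathbf{u}(s)\zeta$ with $\varphi(0,v,\mathbf{u})=v$. The positive orbit of $v$ is $\mathcal{O}^+(v)=\{\varphi(t,v,\mathbf{u}): t\ge 0,\ \mathbf{u}\in\mathcal{U}\}$. LARC: $\langle A\zeta,\theta\zeta\rangle\neq 0$, where $\theta$ is the counter-clockwise rotation by $\pi/2$; equivalently, $\zeta$ is not an eigenvector of $A$. A nonempty set $\mathcal{C}\subset\mathbb{R}^2$ is a control set of $\Sigma_{\mathbb{R}^2}$ if: (1) for every $v\in\mathcal{C}$ there is $\mathbf{u}\in\mathcal{U}$ with $\varphi(t,v,\mathbf{u})\in\mathcal{C}$ for all $t\geq 0$; (2) for every $v\in\mathcal{C}$, $\mathcal{C}\subset\overline{\mathcal{O}^+(v)}$; (3) $\mathcal{C}$ is maximal with respect to set inclusion among sets satisfying (1) and (2). $\Sigma_{\mathbb{R}^2}$ is controllable if $\mathcal{C}=\mathbb{R}^2$ is the only control set of $\Sigma_{\mathbb{R}^2}$. *)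

theory Defs
  imports "HOL-Analysis.Analysis"
begin

definition locally_finite_set :: "real set \<Rightarrow> bool" where
  "locally_finite_set D \<longleftrightarrow> (\<forall>a b. finite (D \<inter> {a..b}))"

text \<open>Only finitely many switching points in each bounded interval are allowed, but possibly
  infinitely many on the whole line. The values at the switching points are arbitrary.\<close>
definition piecewise_constant :: "(real \<Rightarrow> real) \<Rightarrow> bool" where
  "piecewise_constant u \<longleftrightarrow>
     (\<exists>D. locally_finite_set D \<and>
        (\<forall>a b. {a<..<b} \<inter> D = {} \<longrightarrow> u constant_on {a<..<b}))"

definition controls :: "real set \<Rightarrow> (real \<Rightarrow> real) set" where
  "controls \<Omega> = {u. piecewise_constant u \<and> range u \<subseteq> \<Omega>}"

text \<open>The differential equation can only be required away from a locally finite set, as solutions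
  have corners where the control jumps.\<close>
definition is_solution ::
  "real^2^2 \<Rightarrow> real^2 \<Rightarrow> real^2 \<Rightarrow> (real \<Rightarrow> real) \<Rightarrow> (real \<Rightarrow> real^2) \<Rightarrow> bool" where
  "is_solution A \<zeta> v u x \<longleftrightarrow>
     continuous_on UNIV x \<and> x 0 = v \<and>
     (\<exists>D. locally_finite_set D \<and>
        (\<forall>s. s \<notin> D \<longrightarrow> (x has_vector_derivative (A *v x s + u s *\<^sub>R \<zeta>)) (at s)))"

text \<open>For a control \<open>u\<close> the solution exists and is unique, so the description is proper.\<close>
definition flow ::
  "real^2^2 \<Rightarrow> real^2 \<Rightarrow> real \<Rightarrow> real^2 \<Rightarrow> (real \<Rightarrow> real) \<Rightarrow> real^2" where
  "flow A \<zeta> s v u = (THE x. is_solution A \<zeta> v u x) s"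

definition positive_orbit :: "real^2^2 \<Rightarrow> real^2 \<Rightarrow> real set \<Rightarrow> real^2 \<Rightarrow> (real^2) set" where
  "positive_orbit A \<zeta> \<Omega> v = {flow A \<zeta> t v u | t u. t \<ge> 0 \<and> u \<in> controls \<Omega>}"

definition rot90 :: "real^2 \<Rightarrow> real^2" where
  "rot90 v = vector [- (v $ 2), v $ 1]"

definition LARC :: "real^2^2 \<Rightarrow> real^2 \<Rightarrow> bool" where
  "LARC A \<zeta> \<longleftrightarrow> (A *v \<zeta>) \<bullet> rot90 \<zeta> \<noteq> 0"

definition controlled_invariant ::
  "real^2^2 \<Rightarrow> real^2 \<Rightarrow> real set \<Rightarrow> (real^2) set \<Rightarrow> bool" where
  "controlled_invariant A \<zeta> \<Omega> C \<longleftrightarrow>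
     (\<forall>v\<in>C. \<exists>u\<in>controls \<Omega>. \<forall>t\<ge>0. flow A \<zeta> t v u \<in> C)"

definition approx_controllable_on ::
  "real^2^2 \<Rightarrow> real^2 \<Rightarrow> real set \<Rightarrow> (real^2) set \<Rightarrow> bool" where
  "approx_controllable_on A \<zeta> \<Omega> C \<longleftrightarrow>
     (\<forall>v\<in>C. C \<subseteq> closure (positive_orbit A \<zeta> \<Omega> v))"

definition control_set :: "real^2^2 \<Rightarrow> real^2 \<Rightarrow> real set \<Rightarrow> (real^2) set \<Rightarrow> bool" where
  "control_set A \<zeta> \<Omega> C \<longleftrightarrow>
     C \<noteq> {} \<and> controlled_invariant A \<zeta> \<Omega> C \<and> approx_controllable_on A \<zeta> \<Omega> C \<and>
     (\<forall>C'. C \<subseteq> C' \<and> controlled_invariant A \<zeta> \<Omega> C' \<and> approx_controllable_on A \<zeta> \<Omega> C'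
        \<longrightarrow> C' = C)"

definition controllable :: "real^2^2 \<Rightarrow> real^2 \<Rightarrow> real set \<Rightarrow> bool" where
  "controllable A \<zeta> \<Omega> \<longleftrightarrow> (\<forall>C. control_set A \<zeta> \<Omega> C \<longleftrightarrow> C = UNIV)"

end

(* The hypotheses on A make it nilpotent, so the variation of constants formula is a polynomial in A:
   phi(t,v,u) = v + t A v + U(t) zeta + V(t) A zeta, where U and V are the first and second iterated
   primitives of u. By the LARC, zeta and A zeta form a basis, and in the coordinates
   v = x zeta + y A zeta the system is the double integrator x' = u, y' = x.

   If u takes both signs, any two points are joined by a control with a single switch at half time;
   the two values that it needs tend to 0 as the transfer time grows. If u has constant sign (say
   u >= 0), x is nondecreasing along trajectories, and so is y as soon as x >= 0: two points in a
   common control set have the same x, and the same y when one of them has x = 0. If moreover u is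
   bounded away from 0, then x strictly increases and nothing can recur. *)
theory Submission
  imports Defs "HOL-Real_Asymp.Real_Asymp"
begin

section \<open>Locally finite sets and piecewise constant functions\<close>

lemma locally_finite_set_finite: "finite D \<Longrightarrow> locally_finite_set D"
  by (simp add: locally_finite_set_def)

lemma locally_finite_set_Un:
  "locally_finite_set D \<Longrightarrow> locally_finite_set E \<Longrightarrow> locally_finite_set (D \<union> E)"
  by (simp add: locally_finite_set_def Int_Un_distrib2)

lemma locally_finite_set_countable:
  assumes "locally_finite_set D"
  shows "countable D"
proof -
  have "D = (\<Union>n::nat. D \<inter> {-real n..real n})"
  proof (intro equalityI subsetI)
    fix x assume "x \<in> D"
    obtain n :: nat where "\<bar>x\<bar> \<le> real n"
      using real_arch_simple by blast
    with \<open>x \<in> D\<close> show "x \<in> (\<Union>n::nat. D \<inter> {-real n..real n})"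
      by (auto intro!: exI[of _ n])
  qed auto
  moreover have "countable (\<Union>n::nat. D \<inter> {-real n..real n})"
    using assms by (intro countable_UN) (auto simp: locally_finite_set_def countable_finite)
  ultimately show ?thesis by simp
qed

lemma locally_finite_set_gap:
  assumes "locally_finite_set D" "s \<notin> D"
  obtains e where "e > 0" "{s - e<..<s + e} \<inter> D = {}"
proof -
  have "finite (D \<inter> {s - 1..s + 1})"
    using assms by (simp add: locally_finite_set_def)
  then obtain d where d: "d > 0" "\<forall>x\<in>D \<inter> {s - 1..s + 1}. x \<noteq> s \<longrightarrow> d \<le> dist s x"
    using finite_set_avoid by blast
  \<comment> \<open>The bound \<open>d\<close> only concerns points of \<open>D\<close> within
    distance 1 of \<open>s\<close>, hence the cap at 1.\<close>
  have "{s - min d 1<..<s + min d 1} \<inter> D = {}"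
    using d assms(2) by (force simp: dist_real_def)
  then show ?thesis
    using d(1) that[of "min d 1"] by simp
qed

text \<open>Continuity off a locally finite set is what later arguments extract from piecewise
  constancy: it yields integrability, and differentiability of the primitive at all such
  points.\<close>

lemma piecewise_constant_continuous:
  assumes "piecewise_constant u"
  obtains D where "locally_finite_set D" "\<And>s. s \<notin> D \<Longrightarrow> isCont u s"
proof -
  obtain D where D: "locally_finite_set D" "\<And>a b. {a<..<b} \<inter> D = {} \<Longrightarrow> u constant_on {a<..<b}"
    using assms by (auto simp: piecewise_constant_def)
  have "isCont u s" if s: "s \<notin> D" for s
  proof -
    obtain e where e: "e > 0" "{s - e<..<s + e} \<inter> D = {}"
      by (rule locally_finite_set_gap[OF D(1) s])
    obtain c where "\<And>x. x \<in> {s - e<..<s + e} \<Longrightarrow> u x = c"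
      using D(2)[OF e(2)] by (auto simp: constant_on_def)
    then have "continuous_on {s - e<..<s + e} u"
      by (simp cong: continuous_on_cong_simp)
    then show ?thesis
      using e(1) by (simp add: continuous_on_eq_continuous_at)
  qed
  with D(1) show ?thesis by (rule that)
qed

lemma piecewise_constant_const: "piecewise_constant (\<lambda>_. c)"
  unfolding piecewise_constant_def
  by (intro exI[of _ "{}"]) (auto simp: locally_finite_set_finite constant_on_def)

lemma piecewise_constant_switch: "piecewise_constant (\<lambda>s. if s < h then a else b)"
  unfolding piecewise_constant_def
proof (intro exI[of _ "{h}"] conjI allI impI)
  fix l r :: real assume "{l<..<r} \<inter> {h} = {}"
  then consider "r \<le> h" | "h \<le> l" by fastforce
  then show "(\<lambda>s. if s < h then a else b) constant_on {l<..<r}"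
    by cases (force simp: constant_on_def)+
qed (simp add: locally_finite_set_finite)

text \<open>A function continuous off a countable set is Borel measurable, and a bounded measurable
  function is integrable on compact intervals.\<close>

lemma piecewise_constant_integrable:
  assumes "piecewise_constant u" "bounded (range u)"
  shows "u integrable_on {a..b}"
proof -
  obtain D where D: "locally_finite_set D" "\<And>s. s \<notin> D \<Longrightarrow> isCont u s"
    by (rule piecewise_constant_continuous[OF assms(1)]) blast
  obtain B where B: "\<And>s. \<bar>u s\<bar> \<le> B"
    using assms(2) by (auto simp: bounded_iff)
  have "continuous_on (- D) u"
    using D(2) by (intro continuous_at_imp_continuous_on) auto
  then have "u \<in> borel_measurable borel"
    using locally_finite_set_countable[OF D(1)] borel_measurable_continuous_countable_exceptions
    by blast
  then have "u \<in> borel_measurable (lebesgue_on {a..b})"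
    by (intro measurable_restrict_space1 measurable_completion) simp
  then show ?thesis
    by (rule measurable_bounded_by_integrable_imp_integrable_real[where g = "\<lambda>_. B"]) (use B in auto)
qed

section \<open>Primitives\<close>

text \<open>This is the signed integral from 0 to \<open>t\<close>: for \<open>t\<close> nonzero,
  one of the two intervals is empty.\<close>

definition primitive :: "(real \<Rightarrow> real) \<Rightarrow> real \<Rightarrow> real" where
  "primitive f t = integral {0..t} f - integral {t..0} f"

lemma primitive_0 [simp]: "primitive f 0 = 0"
  by (simp add: primitive_def)

lemma primitive_nonneg_eq: "t \<ge> 0 \<Longrightarrow> primitive f t = integral {0..t} f"
  by (cases "t = 0") (auto simp: primitive_def)

text \<open>A base point to the left of both 0 and \<open>t\<close> replaces the signed integral by
  an ordinary indefinite integral up to a constant, so that continuity and differentiability follow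
  for either sign of \<open>t\<close>.\<close>

lemma primitive_shift:
  assumes "\<And>a b. f integrable_on {a..b}" "c \<le> t" "c \<le> 0"
  shows "primitive f t = integral {c..t} f - integral {c..0} f"
proof (cases "t \<ge> 0")
  case True
  then show ?thesis
    using Henstock_Kurzweil_Integration.integral_combine[OF \<open>c \<le> 0\<close> True assms(1)] by (simp add: primitive_nonneg_eq)
next
  case False
  then show ?thesis
    using Henstock_Kurzweil_Integration.integral_combine[OF \<open>c \<le> t\<close> _ assms(1), of 0] by (simp add: primitive_def)
qed

lemma primitive_continuous:
  assumes "\<And>a b. f integrable_on {a..b}"
  shows "continuous_on UNIV (primitive f)"
proof (rule continuous_at_imp_continuous_on, rule ballI)
  fix t :: real
  \<comment> \<open>This choice lies below 0 and makes \<open>{c<..<\<bar>t\<bar> + 1}\<close> an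
    open neighbourhood of \<open>t\<close>, on all of which the shifted formula is valid.\<close>
  define c where "c = - \<bar>t\<bar> - 1"
  have "continuous_on {c..\<bar>t\<bar> + 1} (\<lambda>s. integral {c..s} f - integral {c..0} f)"
    by (intro continuous_intros indefinite_integral_continuous_1 assms)
  then have "continuous_on {c<..<\<bar>t\<bar> + 1} (\<lambda>s. integral {c..s} f - integral {c..0} f)"
    by (rule continuous_on_subset) auto
  moreover have "primitive f s = integral {c..s} f - integral {c..0} f" if "s \<in> {c<..<\<bar>t\<bar> + 1}" for s
    using that by (intro primitive_shift assms) (auto simp: c_def)
  ultimately have "continuous_on {c<..<\<bar>t\<bar> + 1} (primitive f)"
    by (simp cong: continuous_on_cong_simp)
  then show "isCont (primitive f) t"
    by (rule continuous_on_interior) (auto simp: c_def)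
qed

lemma primitive_has_real_derivative:
  assumes "\<And>a b. f integrable_on {a..b}" "isCont f t"
  shows "(primitive f has_real_derivative f t) (at t)"
proof -
  define c where "c = - \<bar>t\<bar> - 1"
  have t: "t \<in> {c<..<\<bar>t\<bar> + 1}"
    by (auto simp: c_def)
  have "((\<lambda>s. integral {c..s} f) has_vector_derivative f t) (at t within {c..\<bar>t\<bar> + 1})"
    using integral_has_vector_derivative_continuous_at[of f c "\<bar>t\<bar> + 1" t "{}"] assms t
    by (auto intro: continuous_within_subset)
  then have "((\<lambda>s. integral {c..s} f) has_real_derivative f t) (at t)"
    using t by (simp add: has_real_derivative_iff_has_vector_derivative at_within_Icc_at)
  then have "((\<lambda>s. integral {c..s} f - integral {c..0} f) has_real_derivative f t) (at t)"
    by (auto intro!: derivative_eq_intros)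
  then show ?thesis
    by (rule has_field_derivative_transform_within_open[OF _ open_greaterThanLessThan t])
      (auto intro!: primitive_shift[symmetric] assms simp: c_def)
qed

text \<open>The factor \<open>\<sigma>\<close> treats nonnegative and nonpositive functions
  together. The lemma serves for a control and, iterated, for its primitive.\<close>

lemma primitive_sign:
  assumes "\<And>s. s \<ge> 0 \<Longrightarrow> \<sigma> * f s \<ge> 0" "t \<ge> 0" "f integrable_on {0..t}"
  shows "\<sigma> * primitive f t \<ge> 0"
proof -
  have "0 \<le> integral {0..t} (\<lambda>s. \<sigma> * f s)"
    using assms by (intro integral_nonneg) (auto intro: integrable_on_mult_right)
  then show ?thesis
    using assms(2) by (simp add: primitive_nonneg_eq)
qed

section \<open>Nilpotent linear control systems\<close>

text \<open>An instance of Cayley-Hamilton: the square of \<open>A\<close> is \<open>trace A\<close>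
  times \<open>A\<close> minus \<open>det A\<close> times the identity.\<close>

lemma trace_det_0_nilpotent:
  fixes A :: "real^2^2"
  assumes "det A = 0" "trace A = 0"
  shows "A *v (A *v w) = 0"
proof -
  define a b c where "a = A$1$1" "b = A$1$2" "c = A$2$1"
  have d: "A$2$2 = - a"
    using assms(2) by (simp add: trace_def sum_2 a_b_c_def)
  have "a * a + b * c = 0"
    using assms(1) by (simp add: det_2 d flip: a_b_c_def)
  \<comment> \<open>Written as a rewrite rule, with a trailing factor \<open>x\<close>, so that it
    applies inside the expanded products.\<close>
  then have *: "b * (c * x) = - a * (a * x)" for x
    by algebra
  show ?thesis
    by (simp add: vec_eq_iff forall_2 matrix_vector_mult_def sum_2 d algebra_simps * flip: a_b_c_def)
qed

text \<open>A compact interval contains only finitely many exceptional points, and continuity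
  carries the constant value across them.\<close>

lemma has_vector_derivative_0_locally_finite:
  fixes f :: "real \<Rightarrow> 'a::banach"
  assumes "continuous_on UNIV f" "locally_finite_set D"
    and "\<And>s. s \<notin> D \<Longrightarrow> (f has_vector_derivative 0) (at s)"
  shows "f s = f 0"
proof -
  have *: "f b = f a" if "a \<le> b" for a b
  proof (rule has_derivative_zero_unique_strong_interval[of "D \<inter> {a..b}" a b f])
    show "finite (D \<inter> {a..b})"
      using assms(2) by (simp add: locally_finite_set_def)
    show "continuous_on {a..b} f"
      using assms(1) continuous_on_subset by blast
    show "(f has_derivative (\<lambda>h. 0)) (at x within {a..b})" if "x \<in> {a..b} - D \<inter> {a..b}" for x
      using assms(3)[of x] that by (auto simp: has_vector_derivative_def intro: has_derivative_at_withinI)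
  qed (use that in auto)
  show ?thesis
    using *[of 0 s] *[of s 0] by (cases "s \<ge> 0") auto
qed

section \<open>Uniqueness and explicit form of the solutions\<close>

locale nilpotent_system =
  fixes A :: "real^2^2" and \<zeta> :: "real^2"
  assumes nilpotent: "\<And>w. A *v (A *v w) = 0"
begin

text \<open>The difference \<open>d\<close> of two solutions satisfies d' = A d off a locally finite
  set. Then A d has derivative A A d = 0, so A d vanishes identically; hence d' = 0 and
  \<open>d\<close> vanishes as well.\<close>

lemma is_solution_unique:
  assumes "is_solution A \<zeta> v u x" "is_solution A \<zeta> v u y"
  shows "x = y"
proof -
  obtain D where D: "locally_finite_set D"
    "\<And>s. s \<notin> D \<Longrightarrow> (x has_vector_derivative (A *v x s + u s *\<^sub>R \<zeta>)) (at s)"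
    using assms(1) by (auto simp: is_solution_def)
  obtain E where E: "locally_finite_set E"
    "\<And>s. s \<notin> E \<Longrightarrow> (y has_vector_derivative (A *v y s + u s *\<^sub>R \<zeta>)) (at s)"
    using assms(2) by (auto simp: is_solution_def)
  define d where "d s = x s - y s" for s
  have DE: "locally_finite_set (D \<union> E)"
    using D(1) E(1) by (rule locally_finite_set_Un)
  have cont: "continuous_on UNIV d" and d0: "d 0 = 0"
    using assms by (auto simp: is_solution_def d_def intro!: continuous_intros)
  have d': "(d has_vector_derivative A *v d s) (at s)" if "s \<notin> D \<union> E" for s
    using has_vector_derivative_diff[OF D(2)[of s] E(2)[of s]] that
    by (simp add: d_def[abs_def] matrix_vector_mult_diff_distrib)
  have bl: "bounded_linear ((*v) A)"
    by (rule matrix_vector_mul_bounded_linear)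
  have "((\<lambda>s. A *v d s) has_vector_derivative 0) (at s)" if "s \<notin> D \<union> E" for s
    using bounded_linear.has_vector_derivative[OF bl d'[OF that]] by (simp add: nilpotent)
  moreover have "continuous_on UNIV (\<lambda>s. A *v d s)"
    using cont bl by (simp add: bounded_linear.continuous_on)
  ultimately have "A *v d s = 0" for s
    using has_vector_derivative_0_locally_finite[OF _ DE, of "\<lambda>s. A *v d s" s] d0 by simp
  then have "d s = 0" for s
    using has_vector_derivative_0_locally_finite[OF cont DE, of s] d' d0 by simp
  then show ?thesis
    by (auto simp: d_def)
qed

lemma flow_eqI:
  assumes "is_solution A \<zeta> v u x"
  shows "flow A \<zeta> t v u = x t"
  unfolding flow_def using assms is_solution_unique by (metis theI)

text \<open>Applying \<open>A\<close> to the candidate leaves only \<open>A *v v\<close> and the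
  multiple \<open>U s\<close> of \<open>A *v \<zeta>\<close>, by nilpotency, which matches its
  derivative. \<open>U\<close> and \<open>V\<close> are kept abstract to cover both integrals and
  closed formulas.\<close>

lemma is_solution_primitives:
  assumes "continuous_on UNIV U" "continuous_on UNIV V" "U 0 = 0" "V 0 = 0" "locally_finite_set D"
    and U: "\<And>s. s \<notin> D \<Longrightarrow> (U has_real_derivative u s) (at s)"
    and V: "\<And>s. s \<notin> D \<Longrightarrow> (V has_real_derivative U s) (at s)"
  shows "is_solution A \<zeta> v u (\<lambda>t. v + t *\<^sub>R (A *v v) + U t *\<^sub>R \<zeta> + V t *\<^sub>R (A *v \<zeta>))"
  unfolding is_solution_def
proof (intro conjI exI[of _ D] allI impI)
  fix s assume "s \<notin> D"
  show "((\<lambda>t. v + t *\<^sub>R (A *v v) + U t *\<^sub>R \<zeta> + V t *\<^sub>R (A *v \<zeta>)) has_vector_derivative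
         A *v (v + s *\<^sub>R (A *v v) + U s *\<^sub>R \<zeta> + V s *\<^sub>R (A *v \<zeta>)) + u s *\<^sub>R \<zeta>) (at s)"
    by (auto intro!: derivative_eq_intros U[OF \<open>s \<notin> D\<close>] V[OF \<open>s \<notin> D\<close>]
        simp: matrix_vector_right_distrib matrix_vector_mult_scaleR nilpotent)
qed (use assms in \<open>auto intro!: continuous_intros\<close>)

text \<open>The iterated primitives supply an actual solution, so the description in
  \<open>flow\<close> is proper for every bounded piecewise constant control.\<close>

lemma flow_eq:
  assumes "piecewise_constant u" "bounded (range u)"
  shows "flow A \<zeta> t v u =
    v + t *\<^sub>R (A *v v) + primitive u t *\<^sub>R \<zeta> + primitive (primitive u) t *\<^sub>R (A *v \<zeta>)"
proof -
  obtain D where D: "locally_finite_set D" "\<And>s. s \<notin> D \<Longrightarrow> isCont u s"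
    by (rule piecewise_constant_continuous[OF assms(1)]) blast
  have u: "u integrable_on {a..b}" for a b
    using assms by (rule piecewise_constant_integrable)
  have cont: "continuous_on UNIV (primitive u)"
    using u by (rule primitive_continuous)
  have Pu: "primitive u integrable_on {a..b}" for a b
    using cont by (intro integrable_continuous_real) (rule continuous_on_subset, auto)
  show ?thesis
  proof (rule flow_eqI, rule is_solution_primitives)
    show "locally_finite_set D" by fact
    show "(primitive u has_real_derivative u s) (at s)" if "s \<notin> D" for s
      using u D(2)[OF that] by (rule primitive_has_real_derivative)
    show "(primitive (primitive u) has_real_derivative primitive u s) (at s)" for s
      using Pu cont by (intro primitive_has_real_derivative) (auto simp: continuous_on_eq_continuous_at)
  qed (use cont primitive_continuous[OF Pu] in auto)
qed

text \<open>For \<open>h\<close> positive, the coefficients of \<open>\<zeta>\<close> and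
  \<open>A *v \<zeta>\<close> contributed by the control are independent linear functions of
  \<open>a\<close> and \<open>b\<close>, so the two values can be solved for a prescribed
  endpoint.\<close>

lemma flow_switch:
  assumes "h \<ge> 0"
  shows "flow A \<zeta> (2 * h) v (\<lambda>s. if s < h then a else b) =
    v + (2 * h) *\<^sub>R (A *v v) + ((a + b) * h) *\<^sub>R \<zeta> + ((3 * a + b) * h\<^sup>2 / 2) *\<^sub>R (A *v \<zeta>)"
proof -
  \<comment> \<open>The ramp \<open>max 0 (s - h)\<close> changes the slope from \<open>a\<close> to
    \<open>b\<close> at \<open>h\<close>. It vanishes at 0 because \<open>h \<ge> 0\<close>, which
    gives \<open>U 0 = 0\<close> and \<open>V 0 = 0\<close>.\<close>
  define U where "U s = a * s + (b - a) * max 0 (s - h)" for s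
  define V where "V s = a * s\<^sup>2 / 2 + (b - a) * (max 0 (s - h))\<^sup>2 / 2" for s
  have "is_solution A \<zeta> v (\<lambda>s. if s < h then a else b)
    (\<lambda>t. v + t *\<^sub>R (A *v v) + U t *\<^sub>R \<zeta> + V t *\<^sub>R (A *v \<zeta>))"
  proof (rule is_solution_primitives)
    fix s assume "s \<notin> {h}"
    then consider "s < h" | "s > h" by fastforce
    then have "(U has_real_derivative (if s < h then a else b)) (at s) \<and>
      (V has_real_derivative U s) (at s)"
    proof cases
      case 1
      have "((\<lambda>s. a * s) has_real_derivative a) (at s)"
        by (auto intro!: derivative_eq_intros)
      then have "(U has_real_derivative a) (at s)"
        by (rule has_field_derivative_transform_within_open[of _ _ s "{..<h}"])
          (use 1 in \<open>auto simp: U_def\<close>)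
      moreover have "((\<lambda>s. a * s\<^sup>2 / 2) has_real_derivative U s) (at s)"
        using 1 by (auto intro!: derivative_eq_intros simp: U_def)
      then have "(V has_real_derivative U s) (at s)"
        by (rule has_field_derivative_transform_within_open[of _ _ s "{..<h}"])
          (use 1 in \<open>auto simp: V_def\<close>)
      ultimately show ?thesis
        using 1 by simp
    next
      case 2
      have "((\<lambda>s. a * s + (b - a) * (s - h)) has_real_derivative b) (at s)"
        by (auto intro!: derivative_eq_intros)
      then have "(U has_real_derivative b) (at s)"
        by (rule has_field_derivative_transform_within_open[of _ _ s "{h<..}"])
          (use 2 in \<open>auto simp: U_def\<close>)
      moreover have "((\<lambda>s. a * s\<^sup>2 / 2 + (b - a) * (s - h)\<^sup>2 / 2) has_real_derivative U s) (at s)"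
        using 2 by (auto intro!: derivative_eq_intros simp: U_def)
      then have "(V has_real_derivative U s) (at s)"
        by (rule has_field_derivative_transform_within_open[of _ _ s "{h<..}"])
          (use 2 in \<open>auto simp: V_def\<close>)
      ultimately show ?thesis
        using 2 by simp
    qed
    then show "(U has_real_derivative (if s < h then a else b)) (at s)"
      "(V has_real_derivative U s) (at s)" by auto
  qed (use assms in \<open>auto simp: U_def V_def locally_finite_set_finite intro!: continuous_intros\<close>)
  then have "flow A \<zeta> (2 * h) v (\<lambda>s. if s < h then a else b) =
      v + (2 * h) *\<^sub>R (A *v v) + U (2 * h) *\<^sub>R \<zeta> + V (2 * h) *\<^sub>R (A *v \<zeta>)"
    by (rule flow_eqI)
  moreover have "U (2 * h) = (a + b) * h" "V (2 * h) = (3 * a + b) * h\<^sup>2 / 2"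
    using assms by (auto simp: U_def V_def field_simps power2_eq_square)
  ultimately show ?thesis by simp
qed

end

section \<open>The double integrator\<close>

text \<open>The coefficient of \<open>a\<close> in the expansion of \<open>v\<close> in the basis \<open>a, b\<close>, by Cramer's rule.\<close>
definition coord :: "real^2 \<Rightarrow> real^2 \<Rightarrow> real^2 \<Rightarrow> real" where
  "coord a b v = (v \<bullet> rot90 b) / (a \<bullet> rot90 b)"

lemma inner_rot90: "v \<bullet> rot90 w = v $ 2 * w $ 1 - v $ 1 * w $ 2"
  by (simp add: rot90_def inner_vec_def sum_2)

lemma coord_expansion:
  assumes "b \<bullet> rot90 a \<noteq> 0"
  shows "v = coord a b v *\<^sub>R a + coord b a v *\<^sub>R b"
proof -
  have "a \<bullet> rot90 b \<noteq> 0"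
    using assms by (simp add: inner_rot90 algebra_simps)
  with assms show ?thesis
    by (simp add: vec_eq_iff forall_2 coord_def inner_rot90 divide_simps) algebra
qed

lemma coord_add: "coord a b (v + w) = coord a b v + coord a b w"
  by (simp add: coord_def inner_add_left add_divide_distrib)

lemma coord_scaleR: "coord a b (c *\<^sub>R v) = c * coord a b v"
  by (simp add: coord_def)

lemma coord_self: "b \<bullet> rot90 a \<noteq> 0 \<Longrightarrow> coord a b a = 1"
  by (simp add: coord_def inner_rot90 algebra_simps)

lemma coord_other: "coord a b b = 0"
  by (simp add: coord_def inner_rot90)

lemma continuous_on_coord [continuous_intros]: "continuous_on S (coord a b)"
  unfolding coord_def divide_inverse by (intro continuous_intros)

text \<open>Control sets only refer to closures of orbits; this carries a lower bound along
  trajectories over to the closure.\<close>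

lemma closure_ge_continuous:
  fixes f :: "'a::topological_space \<Rightarrow> real"
  assumes "continuous_on UNIV f" "\<And>w. w \<in> S \<Longrightarrow> c \<le> f w" "w \<in> closure S"
  shows "c \<le> f w"
proof -
  have "closed {w. c \<le> f w}"
    using assms(1) by (intro closed_Collect_le continuous_intros)
  then have "closure S \<subseteq> {w. c \<le> f w}"
    using assms(2) by (intro closure_minimal) auto
  then show ?thesis
    using assms(3) by auto
qed

section \<open>The system in the basis \<open>\<zeta>\<close>, \<open>A *v \<zeta>\<close>\<close>

locale double_integrator = nilpotent_system +
  assumes larc: "LARC A \<zeta>"
begin

abbreviation X :: "real^2 \<Rightarrow> real" where "X \<equiv> coord \<zeta> (A *v \<zeta>)"
abbreviation Y :: "real^2 \<Rightarrow> real" where "Y \<equiv> coord (A *v \<zeta>) \<zeta>"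

lemma independent: "(A *v \<zeta>) \<bullet> rot90 \<zeta> \<noteq> 0" "\<zeta> \<bullet> rot90 (A *v \<zeta>) \<noteq> 0"
  using larc by (auto simp: LARC_def inner_rot90 algebra_simps)

lemmas expansion = coord_expansion[OF independent(1)]

lemma X_basis [simp]: "X \<zeta> = 1" "X (A *v \<zeta>) = 0"
  by (simp_all add: coord_self coord_other independent)

lemma Y_basis [simp]: "Y \<zeta> = 0" "Y (A *v \<zeta>) = 1"
  by (simp_all add: coord_self coord_other independent)

text \<open>\<open>A\<close> kills the component along \<open>A *v \<zeta>\<close>, so the drift
  moves only \<open>Y\<close>, at rate \<open>X\<close>.\<close>

lemma A_mult: "A *v v = X v *\<^sub>R (A *v \<zeta>)"
proof -
  have "A *v v = A *v (X v *\<^sub>R \<zeta> + Y v *\<^sub>R (A *v \<zeta>))"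
    using expansion[of v] by simp
  then show ?thesis
    by (simp add: matrix_vector_right_distrib matrix_vector_mult_scaleR nilpotent)
qed

lemma controls_mem: "u \<in> controls \<Omega> \<Longrightarrow> u s \<in> \<Omega>"
  by (auto simp: controls_def)

lemma controls_bounded: "bounded \<Omega> \<Longrightarrow> u \<in> controls \<Omega> \<Longrightarrow> piecewise_constant u \<and> bounded (range u)"
  by (auto simp: controls_def intro: bounded_subset)

lemma
  assumes "u \<in> controls \<Omega>" "bounded \<Omega>"
  shows X_flow: "X (flow A \<zeta> t v u) = X v + primitive u t"
    and Y_flow: "Y (flow A \<zeta> t v u) = Y v + t * X v + primitive (primitive u) t"
    and flow_0: "flow A \<zeta> 0 v u = v"
  using controls_bounded[OF assms(2,1)]
  by (simp_all add: flow_eq coord_add coord_scaleR A_mult[of v])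

text \<open>\<open>X\<close> changes by the integral of the control, which has the sign of
  \<open>\<sigma>\<close>.\<close>

lemma closure_orbit_X:
  assumes "bounded \<Omega>" "\<And>r. r \<in> \<Omega> \<Longrightarrow> \<sigma> * r \<ge> 0" "w \<in> closure (positive_orbit A \<zeta> \<Omega> v)"
  shows "\<sigma> * X w \<ge> \<sigma> * X v"
proof (rule closure_ge_continuous[OF _ _ assms(3), where f = "\<lambda>w. \<sigma> * X w"])
  fix w assume "w \<in> positive_orbit A \<zeta> \<Omega> v"
  then obtain t u where tu: "w = flow A \<zeta> t v u" "t \<ge> 0" "u \<in> controls \<Omega>"
    by (auto simp: positive_orbit_def)
  have "\<sigma> * primitive u t \<ge> 0"
    using tu assms controls_bounded[OF assms(1) tu(3)]
    by (intro primitive_sign piecewise_constant_integrable) (auto intro: controls_mem)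
  then show "\<sigma> * X w \<ge> \<sigma> * X v"
    using tu assms(1) by (simp add: X_flow algebra_simps)
qed (intro continuous_intros)

text \<open>\<open>Y\<close> changes by \<open>t * X v\<close> plus the second primitive of the
  control. The first term has the right sign by the assumption on the starting point, the second by
  applying the sign argument twice.\<close>

lemma closure_orbit_Y:
  assumes "bounded \<Omega>" "\<And>r. r \<in> \<Omega> \<Longrightarrow> \<sigma> * r \<ge> 0" "w \<in> closure (positive_orbit A \<zeta> \<Omega> v)"
    and "\<sigma> * X v \<ge> 0"
  shows "\<sigma> * Y w \<ge> \<sigma> * Y v"
proof (rule closure_ge_continuous[OF _ _ assms(3), where f = "\<lambda>w. \<sigma> * Y w"])
  fix w assume "w \<in> positive_orbit A \<zeta> \<Omega> v"
  then obtain t u where tu: "w = flow A \<zeta> t v u" "t \<ge> 0" "u \<in> controls \<Omega>"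
    by (auto simp: positive_orbit_def)
  have u: "u integrable_on {a..b}" for a b
    using controls_bounded[OF assms(1) tu(3)] by (simp add: piecewise_constant_integrable)
  have "\<sigma> * primitive u s \<ge> 0" if "s \<ge> 0" for s
    using tu assms(2) that u by (intro primitive_sign) (auto intro: controls_mem)
  moreover have "primitive u integrable_on {0..t}"
    using primitive_continuous[OF u]
    by (intro integrable_continuous_real) (rule continuous_on_subset, auto)
  ultimately have "\<sigma> * primitive (primitive u) t \<ge> 0"
    using tu(2) by (intro primitive_sign[of \<sigma> "primitive u"])
  moreover have "\<sigma> * (t * X v) \<ge> 0"
    using mult_nonneg_nonneg[OF tu(2) assms(4)] by (simp add: algebra_simps)
  ultimately show "\<sigma> * Y w \<ge> \<sigma> * Y v"
    using tu assms(1) by (simp add: Y_flow algebra_simps)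
qed (intro continuous_intros)

lemma reachable:
  assumes "um < 0" "0 < up"
  shows "w \<in> positive_orbit A \<zeta> {um..up} v"
proof -
  define p r where "p = X w - X v" and "r = Y w - Y v"
  \<comment> \<open>The values \<open>a h\<close> and \<open>b h\<close> solve the two endpoint
    equations stated in \<open>ab\<close>: \<open>p\<close> and \<open>r\<close> are the required
    displacements, and \<open>2 * h * X v\<close> is what the drift adds to \<open>Y\<close> in time
    \<open>2 * h\<close>.\<close>
  define a where "a h = (r - 2 * h * X v) / h\<^sup>2 - p / (2 * h)" for h
  define b where "b h = 3 * p / (2 * h) - (r - 2 * h * X v) / h\<^sup>2" for h
  \<comment> \<open>The drift grows only linearly in \<open>h\<close> but is divided by the square
    of \<open>h\<close>, so for large \<open>h\<close> both values enter the neighbourhood of 0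
    between \<open>um\<close> and \<open>up\<close>.\<close>
  have "(a \<longlongrightarrow> 0) at_top" "(b \<longlongrightarrow> 0) at_top"
    unfolding a_def b_def by real_asymp+
  then have "\<forall>\<^sub>F h in at_top. um < a h \<and> a h < up \<and> um < b h \<and> b h < up \<and> 0 < h"
    using assms by (intro eventually_conj eventually_gt_at_top order_tendstoD)
  then obtain h where h: "um < a h" "a h < up" "um < b h" "b h < up" "0 < h"
    by (metis (no_types, lifting) eventually_at_top_linorder order_refl)
  have ab: "(a h + b h) * h = p" "(3 * a h + b h) * h\<^sup>2 / 2 = r - 2 * h * X v"
    using h(5) by (auto simp: a_def b_def field_simps power2_eq_square)
  have "flow A \<zeta> (2 * h) v (\<lambda>s. if s < h then a h else b h)
      = v + p *\<^sub>R \<zeta> + r *\<^sub>R (A *v \<zeta>)"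
    using h(5) unfolding flow_switch[OF less_imp_le[OF h(5)]] ab
    by (simp add: A_mult[of v] algebra_simps)
  also have "\<dots> = w"
    using expansion[of v] expansion[of w] by (simp add: p_def r_def algebra_simps)
  finally have "w = flow A \<zeta> (2 * h) v (\<lambda>s. if s < h then a h else b h)" by simp
  moreover have "(\<lambda>s. if s < h then a h else b h) \<in> controls {um..up}"
    using h by (auto simp: controls_def piecewise_constant_switch)
  moreover have "2 * h \<ge> 0"
    using h(5) by simp
  ultimately show ?thesis
    unfolding positive_orbit_def by blast
qed

section \<open>Control sets for the three positions of 0\<close>

lemma controllable_if_both_signs:
  assumes "um < 0" "0 < up"
  shows "controllable A \<zeta> {um..up}"
proof -
  have "(\<lambda>_. 0) \<in> controls {um..up}"
    using assms by (auto simp: controls_def piecewise_constant_const)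
  then have "controlled_invariant A \<zeta> {um..up} UNIV"
    by (auto simp: controlled_invariant_def)
  moreover have "approx_controllable_on A \<zeta> {um..up} UNIV"
    using reachable[OF assms] closure_subset by (fastforce simp: approx_controllable_on_def)
  \<comment> \<open>Every control set lies in \<open>UNIV\<close>, which satisfies both conditions,
    so maximality makes the two equal.\<close>
  ultimately show ?thesis
    by (auto simp: controllable_def control_set_def)
qed

text \<open>The points with \<open>X\<close> equal to 0 are equilibria for the zero control. For
  maximality, a point sharing a larger candidate set with \<open>e\<close> can be approached from
  \<open>e\<close> and conversely, and the monotone coordinates then agree.\<close>

lemma one_point_control_set:
  assumes "bounded \<Omega>" "0 \<in> \<Omega>" "\<And>r. r \<in> \<Omega> \<Longrightarrow> \<sigma> * r \<ge> 0" "\<sigma> \<noteq> 0"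
  shows "control_set A \<zeta> \<Omega> {\<alpha> *\<^sub>R (A *v \<zeta>)}"
proof -
  define e where "e = \<alpha> *\<^sub>R (A *v \<zeta>)"
  have e: "X e = 0" "Y e = \<alpha>"
    by (simp_all add: e_def coord_scaleR)
  have zero: "(\<lambda>_. 0) \<in> controls \<Omega>"
    using assms(2) by (auto simp: controls_def piecewise_constant_const)
  have prim: "primitive (\<lambda>_. 0) = (\<lambda>_. 0)"
    by (simp add: fun_eq_iff primitive_def)
  have "flow A \<zeta> t e (\<lambda>_. 0) = e" for t
    by (simp add: flow_eq piecewise_constant_const prim A_mult[of e] e)
  then have "controlled_invariant A \<zeta> \<Omega> {e}"
    using zero by (auto simp: controlled_invariant_def)
  moreover have "e \<in> positive_orbit A \<zeta> \<Omega> e"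
    unfolding positive_orbit_def using zero flow_0[OF zero assms(1), of e, symmetric]
    by (intro CollectI exI[of _ 0] exI[of _ "\<lambda>_. 0"]) simp
  then have "approx_controllable_on A \<zeta> \<Omega> {e}"
    using closure_subset by (fastforce simp: approx_controllable_on_def)
  moreover have "C = {e}" if "{e} \<subseteq> C" and C: "approx_controllable_on A \<zeta> \<Omega> C" for C
  proof -
    have "v = e" if "v \<in> C" for v
    proof -
      have v: "v \<in> closure (positive_orbit A \<zeta> \<Omega> e)" "e \<in> closure (positive_orbit A \<zeta> \<Omega> v)"
        using C \<open>v \<in> C\<close> \<open>{e} \<subseteq> C\<close> by (auto simp: approx_controllable_on_def)
      have "X v = 0"
        using closure_orbit_X[OF assms(1,3) v(1)] closure_orbit_X[OF assms(1,3) v(2)] e assms(4)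
        by simp
      \<comment> \<open>Monotonicity of \<open>Y\<close> starting from \<open>v\<close> presupposes
        \<open>\<sigma> * X v \<ge> 0\<close>, which is available now that
        \<open>X v = 0\<close>.\<close>
      moreover from this have "\<sigma> * Y v = \<sigma> * \<alpha>"
        using closure_orbit_Y[OF assms(1,3) v(1)] closure_orbit_Y[OF assms(1,3) v(2)] e
        by simp
      ultimately show ?thesis
        using expansion[of v] assms(4) by (simp add: e_def)
    qed
    with \<open>{e} \<subseteq> C\<close> show ?thesis by blast
  qed
  ultimately show ?thesis
    unfolding control_set_def e_def[symmetric] by blast
qed

text \<open>In unit time \<open>\<sigma> * X\<close> rises by at least \<open>\<delta>\<close> and
  can never drop afterwards, whereas a trajectory staying in a control set would have to be able to
  return arbitrarily close to its start.\<close>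

lemma no_control_set:
  assumes "bounded \<Omega>" "\<And>r. r \<in> \<Omega> \<Longrightarrow> \<sigma> * r \<ge> \<delta>" "\<delta> > 0"
  shows "\<not> control_set A \<zeta> \<Omega> C"
proof
  assume C: "control_set A \<zeta> \<Omega> C"
  then obtain v where v: "v \<in> C"
    by (auto simp: control_set_def)
  then obtain u where u: "u \<in> controls \<Omega>" "flow A \<zeta> 1 v u \<in> C"
    using C by (force simp: control_set_def controlled_invariant_def)
  have "v \<in> closure (positive_orbit A \<zeta> \<Omega> (flow A \<zeta> 1 v u))"
    using C v u(2) by (auto simp: control_set_def approx_controllable_on_def)
  then have "\<sigma> * X v \<ge> \<sigma> * X (flow A \<zeta> 1 v u)"
    using assms by (intro closure_orbit_X[of \<Omega>]) force+
  then have "\<sigma> * primitive u 1 \<le> 0"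
    using u(1) assms(1) by (simp add: X_flow algebra_simps)
  moreover have "\<sigma> * primitive u 1 \<ge> \<delta>"
  proof -
    have "u integrable_on {0..1}"
      using controls_bounded[OF assms(1) u(1)] by (simp add: piecewise_constant_integrable)
    then have "integral {0..1} (\<lambda>_::real. \<delta>) \<le> integral {0..1} (\<lambda>s. \<sigma> * u s)"
      using assms(2) u(1)
      by (intro integral_le) (auto intro: integrable_on_mult_right controls_mem)
    then show ?thesis
      by (simp add: primitive_nonneg_eq)
  qed
  ultimately show False
    using assms(3) by simp
qed

end

theorem theorem3p1:
  fixes A :: "real^2^2" and \<zeta> :: "real^2" and um up :: real and \<Omega> :: "real set"
  assumes "\<zeta> \<noteq> 0"
    and "um < up"
    and "\<Omega> = {um..up}"
    and "LARC A \<zeta>"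
    and "det A = 0"
    and "trace A = 0"
  shows "(0 \<in> interior \<Omega> \<longrightarrow> controllable A \<zeta> \<Omega>) \<and>
         (0 \<in> frontier \<Omega> \<longrightarrow> (\<forall>\<alpha>::real. control_set A \<zeta> \<Omega> {\<alpha> *\<^sub>R (A *v \<zeta>)})) \<and>
         (0 \<notin> \<Omega> \<longrightarrow> (\<nexists>C. control_set A \<zeta> \<Omega> C))"
proof -
  interpret double_integrator A \<zeta>
    using assms trace_det_0_nilpotent by unfold_locales
  have bounded: "bounded \<Omega>"
    by (simp add: assms(3))
  show ?thesis
  proof (intro conjI impI allI)
    assume "0 \<in> interior \<Omega>"
    then show "controllable A \<zeta> \<Omega>"
      using controllable_if_both_signs by (simp add: assms(3))
  next
    fix \<alpha>
    assume "0 \<in> frontier \<Omega>"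
    then consider "um = 0" | "up = 0"
      using assms(2) by (auto simp: assms(3) frontier_def)
    then show "control_set A \<zeta> \<Omega> {\<alpha> *\<^sub>R (A *v \<zeta>)}"
    proof cases
      \<comment> \<open>All controls share one sign; \<open>\<sigma>\<close> is 1 when they are
        nonnegative and -1 when they are nonpositive.\<close>
      case 1
      then show ?thesis
        using assms(2) by (intro one_point_control_set[OF bounded, of 1]) (auto simp: assms(3))
    next
      case 2
      then show ?thesis
        using assms(2) by (intro one_point_control_set[OF bounded, of "-1"]) (auto simp: assms(3))
    qed
  next
    assume "0 \<notin> \<Omega>"
    then consider "um > 0" | "up < 0"
      by (auto simp: assms(3) not_le)
    then show "\<nexists>C. control_set A \<zeta> \<Omega> C"
    proof cases
      \<comment> \<open>Here \<open>\<delta>\<close> is the distance from 0 to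
        \<open>\<Omega>\<close>, namely \<open>um\<close> or \<open>-up\<close>.\<close>
      case 1
      then show ?thesis
        using no_control_set[OF bounded, of um 1] by (auto simp: assms(3))
    next
      case 2
      then show ?thesis
        using no_control_set[OF bounded, of "-up" "-1"] by (auto simp: assms(3))
    qed
  qed
qed

end
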